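(* If $p \equiv 1 \pmod{4}$ is prime, then there is a polynomial $f(X)$ of degree $4$ with integer coefficients such that $f(X)^{p}+1 = g(X)^{2}+h(X)^{2}$ for some polynomials $g(X)$ and $h(X)$ with integer coefficients, and moreover there is no positive integer $n$ such that $f(n)$ is a perfect square. *)

theory Defs
  imports
    "HOL-Computational_Algebra.Computational_Algebra"
    "HOL-Number_Theory.Number_Theory"
begin

end

theory Submission
  imports Defs "HOL-Library.Discrete_Functions"
begin

text \<open>
  The polynomial is \<open>f = p m\<^sup>2\<close> with a quadratic polynomial \<open>m\<close> that is positive on the positive integers.
  Since \<open>p\<close> divides \<open>f(n)\<close> to an odd power, \<open>f(n)\<close> is never a square. It remains to choose \<open>m\<close> such that
  both factors of

    \<open>f^p + 1 = (f + 1) (1 - f + f\<^sup>2 - \<dots> + f^(p - 1))\<close>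

  are sums of two squares of polynomials; their product is then one, too.

  The second factor is a sum of two squares for every choice of \<open>m\<close>. It is \<open>\<Phi>(-f)\<close>, where \<open>\<Phi>\<close> is the
  \<open>p\<close>-th cyclotomic polynomial. As \<open>p\<close> is \<open>1\<close> modulo \<open>4\<close>, the field of \<open>p\<close>-th roots of unity contains \<open>\<surd>p\<close>, so
  \<open>\<Phi>(p X\<^sup>2)\<close> splits as \<open>F(X) F(-X)\<close> with an integral polynomial \<open>F\<close> (Aurifeuille and Lucas;
  \<open>aurifeuillian_factorization\<close>). For \<open>X = i m\<close> this exhibits \<open>\<Phi>(-p m\<^sup>2)\<close> as the norm of a polynomial over
  the Gaussian integers (\<open>reflection_factor_sum_two_squares\<close>). The factor \<open>F\<close> is the product of
  \<open>1 - (k/p) \<zeta>^k G X\<close> over the nonzero residues \<open>k\<close>, where \<open>(k/p)\<close> is the Legendre symbol and \<open>G\<close> the quadratic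
  Gauss sum, for which \<open>G\<^sup>2 = p\<close>. Its coefficients are rational because the power sums of these roots are
  integers (Newton's identities), and then integral by Gauss's lemma on contents.

  For the first factor, write \<open>p = a\<^sup>2 + b\<^sup>2\<close> and \<open>\<pi> = a + i b\<close>. A polynomial \<open>z\<close> over the Gaussian integers
  for which the product of \<open>z\<close> and the conjugate of \<open>\<pi>\<close> has real part \<open>1\<close> satisfies
  \<open>\<bar>\<pi> m - z\<bar>\<^sup>2 = p m\<^sup>2 - 2 m + \<bar>z\<bar>\<^sup>2\<close>, which equals \<open>p m\<^sup>2 + 1\<close> if \<open>2 m = \<bar>z\<bar>\<^sup>2 - 1\<close>. The linear polynomial
  \<open>z = c + i d + 2 i \<pi> X\<close> with \<open>a c + b d = 1\<close> and \<open>c + d\<close> odd gives such an \<open>m\<close> with integer coefficients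
  (\<open>quadratic_square_plus_one\<close>, \<open>bezout_odd_norm\<close>).
\<close>

section \<open>Newton's identities\<close>

text \<open>
  This is the logarithmic derivative: \<open>P'/P\<close> is the sum of the terms \<open>-r/(1 - r X)\<close>, and expanding
  each of them geometrically gives the power sums of the \<open>r\<close> as coefficients.
\<close>
lemma fps_deriv_prod_linear:
  fixes r :: "'b \<Rightarrow> 'a :: comm_ring_1"
  assumes "finite A"
  shows "fps_deriv (\<Prod>k\<in>A. 1 - fps_const (r k) * fps_X) =
         - (\<Prod>k\<in>A. 1 - fps_const (r k) * fps_X) * Abs_fps (\<lambda>n. \<Sum>k\<in>A. r k ^ Suc n)"
  using assms
proof (induction A)
  case empty
  then show ?case by (simp add: fps_zero_def[symmetric])
next
  case (insert a A)
  define P where "P = (\<Prod>k\<in>A. 1 - fps_const (r k) * fps_X)"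
  define S where "S = Abs_fps (\<lambda>n. \<Sum>k\<in>A. r k ^ Suc n)"
  define T where "T = Abs_fps (\<lambda>n. r a ^ Suc n)"
  have ins: "Abs_fps (\<lambda>n. \<Sum>k\<in>insert a A. r k ^ Suc n) = T + S"
    using insert.hyps by (simp add: fps_eq_iff T_def S_def)
  have geo: "(1 - fps_const (r a) * fps_X) * T = fps_const (r a)"
  proof (rule fps_ext)
    show "fps_nth ((1 - fps_const (r a) * fps_X) * T) n = fps_nth (fps_const (r a)) n" for n
      by (cases n) (simp_all add: T_def left_diff_distrib mult.assoc)
  qed
  have "fps_deriv ((1 - fps_const (r a) * fps_X) * P) =
        - (fps_const (r a) * P) + (1 - fps_const (r a) * fps_X) * (- P * S)"
    using insert.IH by (simp add: P_def S_def algebra_simps)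
  also have "\<dots> = - ((1 - fps_const (r a) * fps_X) * P) * (T + S)"
    by (subst geo[symmetric]) (simp add: algebra_simps)
  finally show ?case
    using insert.hyps by (simp only: ins prod.insert[OF insert.hyps] P_def[symmetric])
qed

text \<open>
  Comparing coefficients of \<open>P' = - P S\<close>, where \<open>S\<close> is the generating function of the power sums.
\<close>
lemma newton_identity_prod_linear:
  fixes r :: "'b \<Rightarrow> 'a :: comm_ring_1"
  assumes "finite A"
  shows "of_nat (Suc n) * poly.coeff (\<Prod>k\<in>A. [:1, - r k:]) (Suc n) =
         - (\<Sum>i\<le>n. poly.coeff (\<Prod>k\<in>A. [:1, - r k:]) i * (\<Sum>k\<in>A. r k ^ Suc (n - i)))"
proof -
  let ?P = "\<Prod>k\<in>A. [:1, - r k:]"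
  have fps: "fps_of_poly ?P = (\<Prod>k\<in>A. 1 - fps_const (r k) * fps_X)"
    unfolding fps_of_poly_prod
    by (intro prod.cong refl) (simp add: fps_of_poly_pCons flip: fps_const_neg)
  have "of_nat (Suc n) * poly.coeff ?P (Suc n) = fps_nth (fps_deriv (fps_of_poly ?P)) n"
    by simp
  also have "\<dots> = - (\<Sum>i\<le>n. poly.coeff ?P i * (\<Sum>k\<in>A. r k ^ Suc (n - i)))"
    unfolding fps fps_deriv_prod_linear[OF assms]
    unfolding fps[symmetric] by (simp add: fps_mult_nth atLeast0AtMost sum_negf)
  finally show ?thesis .
qed

text \<open>
  Solving Newton's identity for the \<open>n\<close>-th coefficient costs one division by \<open>n\<close>, so integral
  power sums yield coefficients whose denominators divide a factorial. This replaces a Galois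
  argument for the rationality of the coefficients.
\<close>
lemma fact_mult_coeff_prod_linear_in_Ints:
  fixes r :: "'b \<Rightarrow> 'a :: {comm_ring_1, ring_char_0}"
  assumes "finite A" "\<And>n. 0 < n \<Longrightarrow> n \<le> N \<Longrightarrow> (\<Sum>k\<in>A. r k ^ n) \<in> \<int>" "n \<le> N"
  shows "fact n * poly.coeff (\<Prod>k\<in>A. [:1, - r k:]) n \<in> \<int>"
  using assms(3)
proof (induction n rule: less_induct)
  case (less n)
  let ?c = "poly.coeff (\<Prod>k\<in>A. [:1, - r k:])"
  show ?case
  proof (cases n)
    case 0
    have "poly (\<Prod>k\<in>A. [:1, - r k:]) 0 = 1" by (simp add: poly_prod)
    then show ?thesis using 0 by (simp add: poly_0_coeff_0)
  next
    case (Suc m)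
    have "fact m * ?c i * (\<Sum>k\<in>A. r k ^ Suc (m - i)) \<in> \<int>" if "i \<le> m" for i
    proof (rule Ints_mult)
      have "fact i dvd (fact m :: int)" using that by (rule fact_dvd)
      then obtain q where q: "(fact m :: int) = fact i * q" ..
      have "(fact m :: 'a) = of_int (fact m)" by simp
      also have "\<dots> = of_int q * fact i" unfolding q by (simp add: mult.commute)
      finally have "fact m * ?c i = of_int q * (fact i * ?c i)" by (simp add: mult.assoc)
      moreover have "fact i * ?c i \<in> \<int>" using less that Suc by auto
      ultimately show "fact m * ?c i \<in> \<int>" by auto
      show "(\<Sum>k\<in>A. r k ^ Suc (m - i)) \<in> \<int>"
        using less.prems Suc by (intro assms(2)) auto
    qed
    then have "- (\<Sum>i\<le>m. fact m * ?c i * (\<Sum>k\<in>A. r k ^ Suc (m - i))) \<in> \<int>"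
      by (intro Ints_minus Ints_sum) auto
    also have "- (\<Sum>i\<le>m. fact m * ?c i * (\<Sum>k\<in>A. r k ^ Suc (m - i))) = fact m * (of_nat (Suc m) * ?c (Suc m))"
      unfolding newton_identity_prod_linear[OF assms(1)] by (simp add: sum_distrib_left mult.assoc)
    also have "\<dots> = fact n * ?c n" using Suc by (simp add: algebra_simps)
    finally show ?thesis .
  qed
qed

section \<open>Polynomials and the reflection X to -X\<close>
lemma pcompose_power:
  fixes q r :: "'a :: comm_semiring_1 poly"
  shows "pcompose (q ^ n) r = pcompose q r ^ n"
  by (induction n) (simp_all add: pcompose_mult pcompose_1)

lemma content_pcompose_uminus:
  fixes p :: "int poly"
  shows "content (pcompose p [:0, -1:]) = content p"
proof -
  have sign: "c dvd (- 1) ^ n * x \<longleftrightarrow> c dvd x" for c x :: int and n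
    by (cases "even n") auto
  have iff: "c dvd content (pcompose p [:0, -1:]) \<longleftrightarrow> c dvd content p" for c
    by (simp only: const_poly_dvd_iff coeff_pcompose_linear sign flip: const_poly_dvd_iff_dvd_content)
  show ?thesis
    by (rule associated_eqI) (simp_all only: iff[of "content p"] iff[symmetric] dvd_refl normalize_content)
qed

text \<open>
  Gauss's lemma: \<open>H(X)\<close> and \<open>H(-X)\<close> have the same content, so that content squared is \<open>D\<^sup>2\<close>. Hence the
  denominator that was cleared by multiplying with \<open>D\<close> can be divided out again.
\<close>
lemma gauss_reflection_factor:
  fixes H S :: "int poly"
  assumes "H * pcompose H [:0, -1:] = Polynomial.smult (D ^ 2) S" "content S = 1" "D > 0"
  shows "\<exists>F. H = Polynomial.smult D F \<and> F * pcompose F [:0, -1:] = S"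
proof -
  have "content H ^ 2 = D ^ 2"
    using arg_cong[OF assms(1), of content] assms(2)
    by (simp add: content_mult content_pcompose_uminus power2_eq_square)
  moreover have "content H \<ge> 0"
    using normalize_content[of H] by (subst (asm) normalize_int_def) linarith
  ultimately have "content H = D" using assms(3) by (simp add: power2_eq_iff_nonneg)
  then have "[:D:] dvd H" using content_dvd[of H] by simp
  then obtain F where F: "H = Polynomial.smult D F" by auto
  have "Polynomial.smult (D ^ 2) (F * pcompose F [:0, -1:]) = Polynomial.smult (D ^ 2) S"
    using assms(1) unfolding F by (simp add: pcompose_smult power2_eq_square)
  then have "F * pcompose F [:0, -1:] = S"
    by (rule smult_cancel[rotated]) (use assms(3) in simp)
  with F show ?thesis by blast
qed

lemma even_odd_decomposition:
  fixes F :: "'a :: comm_ring_1 poly"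
  obtains E R where "F = pcompose E [:0, 0, 1:] + [:0, 1:] * pcompose R [:0, 0, 1:]"
proof -
  have "\<exists>E R. F = pcompose E [:0, 0, 1:] + [:0, 1:] * pcompose R [:0, 0, 1:]"
  proof (induction F)
    case 0
    show ?case by (rule exI[of _ 0], rule exI[of _ 0]) simp
  next
    case (pCons a F)
    then obtain E R where "F = pcompose E [:0, 0, 1:] + [:0, 1:] * pcompose R [:0, 0, 1:]" by blast
    then have "pCons a F = pcompose (pCons a R) [:0, 0, 1:] + [:0, 1:] * pcompose E [:0, 0, 1:]"
      by (simp add: pcompose_pCons)
    then show ?case by blast
  qed
  with that show ?thesis by blast
qed

text \<open>
  Over a ring containing a square root \<open>i\<close> of \<open>-1\<close>, substituting \<open>X = i m\<close> turns the left-hand side of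
  the assumption into \<open>F(i m) F(- i m)\<close>, a product of conjugates and so a sum of two squares. Separating \<open>F\<close> into
  its even and odd parts, \<open>F = E(X\<^sup>2) + X R(X\<^sup>2)\<close>, makes this explicit without adjoining \<open>i\<close>: the
  assumption becomes \<open>T = E\<^sup>2 - X R\<^sup>2\<close>, where \<open>X\<close> may be replaced by \<open>-m\<^sup>2\<close>.
\<close>
lemma reflection_factor_sum_two_squares:
  fixes F T m :: "'a :: idom poly"
  assumes "F * pcompose F [:0, -1:] = pcompose T [:0, 0, 1:]"
  shows "\<exists>g h. pcompose T (- (m ^ 2)) = g ^ 2 + h ^ 2"
proof -
  obtain E R where F: "F = pcompose E [:0, 0, 1:] + [:0, 1:] * pcompose R [:0, 0, 1:]"
    by (rule even_odd_decomposition)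
  have sq: "pcompose [:0, 0, 1:] [:0, -1:] = ([:0, 0, 1:] :: 'a poly)"
    by (simp add: pcompose_pCons)
  \<comment> \<open>The factor \<open>X\<close> changes sign under the reflection, while the polynomials in \<open>X\<^sup>2\<close> are fixed.\<close>
  have F': "pcompose F [:0, -1:] = pcompose E [:0, 0, 1:] - [:0, 1:] * pcompose R [:0, 0, 1:]"
    unfolding F pcompose_add pcompose_mult by (simp add: sq pcompose_pCons flip: pcompose_assoc)
  have "pcompose (E ^ 2 - [:0, 1:] * R ^ 2) [:0, 0, 1:] = F * pcompose F [:0, -1:]"
    unfolding F' unfolding F
    by (simp add: pcompose_diff pcompose_mult pcompose_pCons power2_eq_square algebra_simps)
  then have "pcompose (E ^ 2 - [:0, 1:] * R ^ 2 - T) [:0, 0, 1:] = 0"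
    by (simp add: pcompose_diff assms)
  then have "E ^ 2 - [:0, 1:] * R ^ 2 - T = 0"
    by (rule pcompose_eq_0) simp
  then have "T = E ^ 2 - [:0, 1:] * R ^ 2" by simp
  then have "pcompose T (- (m ^ 2)) =
      pcompose E (- (m ^ 2)) ^ 2 + (m * pcompose R (- (m ^ 2))) ^ 2"
    by (simp only:) (simp add: pcompose_diff pcompose_mult pcompose_pCons power2_eq_square algebra_simps)
  then show ?thesis by blast
qed

section \<open>The Legendre symbol\<close>
lemma Legendre_range: "Legendre a p \<in> {-1, 0, 1}"
  by (simp add: Legendre_def)

lemma Legendre_cong: "[a = b] (mod p) \<Longrightarrow> Legendre a p = Legendre b p"
proof -
  assume ab: "[a = b] (mod p)"
  then have "[y = a] (mod p) \<longleftrightarrow> [y = b] (mod p)" "[a = y] (mod p) \<longleftrightarrow> [b = y] (mod p)" for y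
    by (simp_all add: cong_def)
  then show ?thesis unfolding Legendre_def QuadRes_def by simp
qed

text \<open>
  Euler's criterion determines the symbol only modulo \<open>p\<close>; since \<open>p > 2\<close>, the three possible values are
  pairwise incongruent.
\<close>
lemma Legendre_eqI:
  assumes "p > 2" "[Legendre a (int p) = x] (mod int p)" "x \<in> {-1, 0, 1}"
  shows "Legendre a (int p) = x"
proof -
  have "int p dvd Legendre a (int p) - x"
    using assms(2) by (simp add: cong_iff_dvd_diff)
  moreover have "\<bar>Legendre a (int p) - x\<bar> < \<bar>int p\<bar>"
    using Legendre_range[of a "int p"] assms(1,3)
    by (elim insertE emptyE) simp_all
  ultimately show ?thesis using dvd_imp_le_int[of "Legendre a (int p) - x" "int p"] by linarith
qed

lemma Legendre_mult:
  assumes "prime p" "p > 2"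
  shows "Legendre (a * b) (int p) = Legendre a (int p) * Legendre b (int p)"
proof (rule Legendre_eqI[OF assms(2)])
  show "[Legendre (a * b) (int p) = Legendre a (int p) * Legendre b (int p)] (mod int p)"
    using euler_criterion[OF assms, of "a * b"]
          cong_mult[OF euler_criterion[OF assms, of a] euler_criterion[OF assms, of b]]
    by (simp add: power_mult_distrib) (metis cong_sym cong_trans)
  show "Legendre a (int p) * Legendre b (int p) \<in> {-1, 0, 1}"
    using Legendre_range[of a "int p"] Legendre_range[of b "int p"] by auto
qed

lemma Legendre_minus_one:
  assumes "prime p" "[p = 1] (mod 4)"
  shows "Legendre (- 1) (int p) = 1"
proof -
  have "p > 2" using assms prime_ge_2_nat[of p] by (cases "p = 2") (auto simp: cong_def)
  moreover from assms(2) have "even ((p - 1) div 2)"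
    unfolding cong_def by presburger
  ultimately show ?thesis
    using euler_criterion[OF assms(1), of "-1"] by (intro Legendre_eqI) auto
qed

text \<open>
  A primitive root cannot be a square, as its power with exponent \<open>(p - 1)/2\<close> differs from \<open>1\<close>.
\<close>
lemma exists_Legendre_eq_minus_one:
  assumes "prime p" "p > 2"
  shows "\<exists>n. 0 < n \<and> n < p \<and> Legendre (int n) (int p) = -1"
proof -
  obtain g where g: "residue_primroot p g"
    using prime_primitive_root_exists[of p] assms prime_gt_1_nat[of p] by auto
  define n where "n = g mod p"
  have ord: "ord p g = p - 1" and cop: "coprime p g"
    using g assms(1) by (auto simp: residue_primroot_def totient_prime)
  then have "\<not> p dvd g" using assms(1)
    by (metis coprime_common_divisor dvd_refl not_prime_unit)
  then have n: "0 < n" "n < p" using assms(2) by (auto simp: n_def mod_greater_zero_iff_not_dvd)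
  have "Legendre (int n) (int p) \<noteq> 1"
  proof
    assume "Legendre (int n) (int p) = 1"
    then have "[1 = int n ^ ((p - 1) div 2)] (mod int p)"
      using euler_criterion[OF assms, of "int n"] by simp
    then have "[n ^ ((p - 1) div 2) = 1] (mod p)"
      by (metis cong_int_iff cong_sym of_nat_1 of_nat_power)
    then have "[g ^ ((p - 1) div 2) = 1] (mod p)"
      by (simp add: n_def cong_def power_mod)
    then have "(p - 1) dvd (p - 1) div 2" using ord_divides[of g _ p] ord by simp
    moreover have "0 < (p - 1) div 2" "(p - 1) div 2 < p - 1" using assms(2) by auto
    ultimately show False by (meson nat_dvd_not_less)
  qed
  moreover have "Legendre (int n) (int p) \<noteq> 0"
    using n by (auto simp: Legendre_def cong_def)
  ultimately have "Legendre (int n) (int p) = -1"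
    using Legendre_range[of "int n" "int p"] by auto
  with n show ?thesis by blast
qed

section \<open>Roots of unity\<close>
lemma sum_roots_of_unity:
  assumes "p > 0"
  shows "(\<Sum>k<p. cis (2 * pi / p) ^ (k * n)) = (if p dvd n then of_nat p else 0)"
proof -
  define w where "w = cis (2 * pi / p) ^ n"
  have zp: "cis (2 * pi / p) ^ p = 1" using assms by (simp add: DeMoivre)
  have w: "cis (2 * pi / p) ^ (k * n) = w ^ k" for k
    by (simp add: w_def mult.commute flip: power_mult)
  have "w ^ p = 1"
    by (simp add: w_def flip: power_mult) (metis zp mult.commute power_mult power_one)
  have "w = 1 \<longleftrightarrow> p dvd n"
  proof
    assume "p dvd n"
    then show "w = 1" using zp by (auto simp: w_def power_mult)
  next
    assume "w = 1"
    have *: "cis (2 * pi / p) ^ k = cis (2 * pi * real k / p)" for k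
      by (simp add: DeMoivre mult_ac)
    have "cis (2 * pi / p) ^ n = cis (2 * pi / p) ^ (n mod p + p * (n div p))" by simp
    also have "\<dots> = cis (2 * pi / p) ^ (n mod p)"
      unfolding power_add power_mult zp by simp
    finally have "cis (2 * pi * real (n mod p) / p) = cis (2 * pi * real 0 / p)"
      using \<open>w = 1\<close> by (simp add: w_def *)
    moreover have "inj_on (\<lambda>k. cis (2 * pi * real k / p)) {..<p}"
      using bij_betw_roots_unity[OF assms] by (simp add: bij_betw_def)
    ultimately have "n mod p = 0"
      using assms by (auto simp: inj_on_def)
    then show "p dvd n" by auto
  qed
  with \<open>w ^ p = 1\<close> show ?thesis
    unfolding w by (auto simp: sum_gp_strict)
qed

lemma prod_roots_of_unity_linear:
  assumes "p > 0"
  shows "(\<Prod>z | z ^ p = 1. [:1, - z:]) = (1 - [:0, 1:] ^ p :: complex poly)"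
proof (rule poly_eqI_degree[where A = "insert 0 {z. z ^ p = 1}"])
  have fin: "finite {z :: complex. z ^ p = 1}" and card: "card {z :: complex. z ^ p = 1} = p"
    using assms finite_roots_unity[of p] card_roots_unity_eq[of p] by auto
  have c: "card (insert 0 {z :: complex. z ^ p = 1}) = Suc p"
    using assms fin card by (subst card_insert_disjoint) (auto simp: power_0_left)
  have "degree (\<Prod>z | z ^ p = 1. [:1, - z:] :: complex poly) \<le> (\<Sum>z :: complex | z ^ p = 1. 1)"
    by (rule order.trans[OF degree_prod_sum_le[OF fin]]) (auto intro!: sum_mono simp: degree_pCons_le simp del: sum_constant)
  then show "card (insert 0 {z :: complex. z ^ p = 1}) > degree (\<Prod>z | z ^ p = 1. [:1, - z:] :: complex poly)"
    using c card by simp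
  have "degree (1 - [:0, 1:] ^ p :: complex poly) \<le> p"
    by (intro degree_diff_le) (auto simp: degree_power_eq)
  then show "card (insert 0 {z :: complex. z ^ p = 1}) > degree (1 - [:0, 1:] ^ p :: complex poly)"
    using c by simp
  fix x :: complex assume "x \<in> insert 0 {z. z ^ p = 1}"
  then consider "x = 0" | "x \<noteq> 0" "x ^ p = 1" by auto
  then show "poly (\<Prod>z | z ^ p = 1. [:1, - z:]) x = poly (1 - [:0, 1:] ^ p) x"
  proof cases
    case 1
    then show ?thesis using assms by (simp add: poly_prod poly_power)
  next
    case 2
    then have "inverse x \<in> {z. z ^ p = 1}" "poly [:1, - inverse x:] x = 0"
      by (auto simp: power_inverse)
    then have "poly (\<Prod>z | z ^ p = 1. [:1, - z:]) x = 0"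
      using fin by (simp only: poly_prod) (rule prod_zero, auto)
    then show ?thesis using 2 by (simp add: poly_power)
  qed
qed

section \<open>Sums of two squares\<close>

text \<open>
  Thue's argument: choose \<open>x\<close> with \<open>x\<^sup>2 = -1\<close> modulo \<open>p\<close>. There are more than \<open>p\<close> pairs \<open>(u, v)\<close> of numbers
  between \<open>0\<close> and \<open>\<lfloor>\<surd>p\<rfloor>\<close>, so two of them have the same value of \<open>u x - v\<close> modulo \<open>p\<close>. Their difference
  \<open>(a, b)\<close> satisfies \<open>p dvd a\<^sup>2 + b\<^sup>2\<close> and \<open>0 < a\<^sup>2 + b\<^sup>2 < 2 p\<close>.
\<close>
lemma sum_two_squares_prime:
  assumes "prime p" "[p = 1] (mod 4)"
  shows "\<exists>a b :: int. int p = a ^ 2 + b ^ 2"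
proof -
  have "Legendre (- 1) (int p) = 1" by (rule Legendre_minus_one) fact+
  then obtain x where x: "[x ^ 2 = - 1] (mod int p)"
    by (auto simp: Legendre_def QuadRes_def split: if_splits)
  define s where "s = floor_sqrt p"
  have p0: "p > 0" using assms prime_gt_0_nat by blast
  have s1: "s ^ 2 \<le> p" "p < (s + 1) ^ 2"
    unfolding s_def using Suc_floor_sqrt_power2_gt by auto
  have s2: "s ^ 2 < p"
  proof -
    have "s ^ 2 \<noteq> p" using assms(1) prime_power_iff[of s 2] by auto
    then show ?thesis using s1 by simp
  qed
  define B where "B = {0..s} \<times> {0..s}"
  define \<phi> where "\<phi> = (\<lambda>(u, v). (int u * x - int v) mod int p)"
  have "\<phi> ` B \<subseteq> {0..<int p}" using p0 by (auto simp: \<phi>_def)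
  then have "card (\<phi> ` B) \<le> p" using card_mono[of "{0..<int p}" "\<phi> ` B"] by simp
  also have "p < card B" using s1 by (simp add: B_def power2_eq_square)
  finally have "\<not> inj_on \<phi> B" using card_image[of \<phi> B] by auto
  then obtain u v u' v' where uv: "(u, v) \<noteq> (u', v')" "\<phi> (u, v) = \<phi> (u', v')"
      "u \<le> s" "v \<le> s" "u' \<le> s" "v' \<le> s"
    unfolding inj_on_def B_def by fastforce
  define a where "a = int u - int u'"
  define b where "b = int v - int v'"
  have "[int u * x - int v = int u' * x - int v'] (mod int p)"
    using uv(2) by (simp add: \<phi>_def cong_def)
  then have 1: "int p dvd a * x - b"
    by (simp add: cong_iff_dvd_diff a_def b_def algebra_simps)
  have 2: "int p dvd x ^ 2 + 1" using x by (simp add: cong_iff_dvd_diff)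
  have "a ^ 2 + b ^ 2 = a ^ 2 * (x ^ 2 + 1) - (a * x - b) * (a * x + b)"
    by (simp add: algebra_simps power2_eq_square)
  then have dvd: "int p dvd a ^ 2 + b ^ 2"
    using dvd_diff[OF dvd_mult[OF 2] dvd_mult2[OF 1]] by simp
  have "a ^ 2 \<le> int s ^ 2" "b ^ 2 \<le> int s ^ 2"
    using uv unfolding a_def b_def by (simp_all add: power2_le_iff_abs_le)
  moreover have "int s ^ 2 < int p" using s2 by (metis of_nat_less_iff of_nat_power)
  ultimately have lt: "a ^ 2 + b ^ 2 < 2 * int p" by linarith
  have "a \<noteq> 0 \<or> b \<noteq> 0" using uv(1) by (auto simp: a_def b_def)
  then have pos: "a ^ 2 + b ^ 2 > 0" by (simp add: sum_power2_gt_zero_iff)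
  from dvd obtain q where q: "a ^ 2 + b ^ 2 = int p * q" ..
  have "0 < q" using pos q p0 by (simp add: zero_less_mult_iff)
  moreover have "q < 2" using lt q p0 by (simp add: mult.commute)
  ultimately have "q = 1" by simp
  with q have "int p = a ^ 2 + b ^ 2" by simp
  then show ?thesis by blast
qed

text \<open>
  For real values of the letters put \<open>\<pi> = a + i b\<close> and \<open>z = c + i d + 2 i \<pi> X\<close>. Then the right-hand side is
  \<open>\<bar>\<pi> m - z\<bar>\<^sup>2\<close>, the product of \<open>z\<close> and the conjugate of \<open>\<pi>\<close> has real part \<open>a c + b d = 1\<close>, and
  \<open>\<bar>z\<bar>\<^sup>2 = 2 m + 1\<close>. Expanding the square gives \<open>p m\<^sup>2 - 2 m + \<bar>z\<bar>\<^sup>2\<close>, so the terms linear in \<open>m\<close> cancel.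
\<close>
lemma quadratic_square_plus_one:
  fixes p a b c d t X m :: "'a :: comm_ring_1"
  assumes "p = a ^ 2 + b ^ 2" "a * c + b * d = 1" "c ^ 2 + d ^ 2 = 2 * t + 1"
    and "m = 2 * p * X ^ 2 + 2 * (a * d - b * c) * X + t"
  shows "p * m ^ 2 + 1 = (a * m - c + 2 * b * X) ^ 2 + (b * m - d - 2 * a * X) ^ 2"
proof -
  have "(a * m - c + 2 * b * X) ^ 2 + (b * m - d - 2 * a * X) ^ 2 =
    (a ^ 2 + b ^ 2) * m ^ 2 - 2 * m * (a * c + b * d) +
    (c ^ 2 + d ^ 2 + 4 * (a ^ 2 + b ^ 2) * X ^ 2 + 4 * (a * d - b * c) * X)"
    by (simp add: algebra_simps power2_eq_square)
  also have "\<dots> = p * m ^ 2 - 2 * m + (2 * t + 1 + 4 * p * X ^ 2 + 4 * (a * d - b * c) * X)"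
    using assms(1-3) by simp
  also have "\<dots> = p * m ^ 2 + 1" unfolding assms(4) by (simp add: algebra_simps)
  finally show ?thesis ..
qed

text \<open>
  The solutions of \<open>a c + b d = 1\<close> form a line in direction \<open>(-b, a)\<close>. A step along it changes the parity
  of \<open>c + d\<close>, since \<open>a + b\<close> is odd, and increases \<open>a d - b c\<close> by \<open>a\<^sup>2 + b\<^sup>2 > 0\<close>. So a solution far enough
  along the line, of the right parity, has both required properties.
\<close>
lemma bezout_odd_norm:
  fixes a b :: int
  assumes "coprime a b" "odd (a + b)"
  shows "\<exists>c d t. a * c + b * d = 1 \<and> c ^ 2 + d ^ 2 = 2 * t + 1 \<and> a * d - b * c \<ge> 0 \<and> t \<ge> 0"
proof -
  obtain c0 d0 where 0: "a * c0 + b * d0 = 1"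
    using bezout_int[of a b] assms(1) by (auto simp: mult.commute)
  define s where "s = a * d0 - b * c0"
  \<comment> \<open>At least \<open>\<bar>s\<bar>\<close> steps make the determinant nonnegative; one more adjusts the parity if necessary.\<close>
  define j where "j = (if odd (c0 + d0 + \<bar>s\<bar>) then \<bar>s\<bar> else \<bar>s\<bar> + 1)"
  define c d where "c = c0 - j * b" and "d = d0 + j * a"
  have "odd (c + d)" using assms(2) unfolding c_def d_def j_def by auto
  then have "odd (c ^ 2 + d ^ 2)" by simp
  then obtain t where t: "c ^ 2 + d ^ 2 = 2 * t + 1" using oddE by blast
  have "a ^ 2 + b ^ 2 > 0" using assms by (auto simp: sum_power2_gt_zero_iff)
  then have "j * (a ^ 2 + b ^ 2) \<ge> j * 1" unfolding j_def by (intro mult_left_mono) auto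
  moreover have "a * d - b * c = s + j * (a ^ 2 + b ^ 2)"
    by (simp add: c_def d_def s_def algebra_simps power2_eq_square)
  moreover have "j \<ge> \<bar>s\<bar>" by (simp add: j_def)
  ultimately have "a * d - b * c \<ge> 0" by linarith
  moreover have "a * c + b * d = 1" using 0 by (simp add: c_def d_def algebra_simps)
  moreover have "t \<ge> 0" using t sum_power2_ge_zero[of c d] by linarith
  ultimately show ?thesis using t by blast
qed

section \<open>The Aurifeuillian factorization\<close>

context
  fixes p :: nat
  assumes prime: "prime p" and p_mod_4: "[p = 1] (mod 4)"
begin

definition chi :: "nat \<Rightarrow> complex" where "chi k = of_int (Legendre (int k) (int p))"

definition zeta :: complex where "zeta = cis (2 * pi / p)"

definition gauss_sum :: complex where "gauss_sum = (\<Sum>k=1..<p. chi k * zeta ^ k)"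

lemma p_gt_2: "p > 2"
  using prime p_mod_4 prime_ge_2_nat[of p] by (cases "p = 2") (auto simp: cong_def)

lemma chi_mod: "chi (k mod p) = chi k"
  unfolding chi_def by (intro arg_cong[where f = of_int] Legendre_cong) (simp add: cong_def zmod_int)

lemma chi_mult: "chi (a * b) = chi a * chi b"
  by (simp add: chi_def Legendre_mult[OF prime p_gt_2])

lemma chi_square: "k \<in> {1..<p} \<Longrightarrow> chi k ^ 2 = 1"
  by (auto simp: chi_def Legendre_def cong_def simp flip: zmod_int)

lemma chi_p_minus_1: "chi (p - 1) = 1"
proof -
  have "[int (p - 1) = - 1] (mod int p)"
    using p_gt_2 by (simp add: cong_iff_dvd_diff of_nat_diff)
  then show ?thesis
    using Legendre_minus_one[OF prime p_mod_4] Legendre_cong by (simp add: chi_def)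
qed

lemma zeta_mod: "zeta ^ (k mod p) = zeta ^ k"
proof -
  have "zeta ^ p = 1" using p_gt_2 by (simp add: zeta_def DeMoivre)
  then have "zeta ^ (p * (k div p) + k mod p) = zeta ^ (k mod p)"
    by (simp only: power_add power_mult) simp
  then show ?thesis by simp
qed

text \<open>
  This justifies substituting \<open>n k\<close> for \<open>k\<close> in sums and products over the nonzero residues.
\<close>
lemma bij_betw_mult_mod_prime:
  assumes "n \<in> {1..<p}"
  shows "bij_betw (\<lambda>k. n * k mod p) {1..<p} {1..<p}"
proof -
  have ndvd: "\<not> p dvd k" if "k \<in> {1..<p}" for k
    using that by (auto dest: dvd_imp_le)
  have cop: "coprime n p"
    using ndvd[OF assms] prime by (metis coprime_commute prime_imp_coprime)
  have "inj_on (\<lambda>k. n * k mod p) {1..<p}"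
  proof (rule inj_onI)
    fix j k assume "j \<in> {1..<p}" "k \<in> {1..<p}" "n * j mod p = n * k mod p"
    then have "[j = k] (mod p)"
      using cong_mult_lcancel_nat[OF cop] by (simp add: cong_def)
    then show "j = k" using \<open>j \<in> _\<close> \<open>k \<in> _\<close> by (simp add: cong_def)
  qed
  moreover have "(\<lambda>k. n * k mod p) ` {1..<p} \<subseteq> {1..<p}"
  proof safe
    fix k assume "k \<in> {1..<p}"
    then have "\<not> p dvd n * k"
      using ndvd ndvd[OF assms] prime by (simp add: prime_dvd_mult_iff)
    then show "n * k mod p \<in> {1..<p}"
      using p_gt_2 by (simp add: Suc_le_eq mod_greater_zero_iff_not_dvd)
  qed
  ultimately show ?thesis by (simp add: bij_betw_def endo_inj_surj)
qed

lemma sum_chi: "(\<Sum>k=1..<p. chi k) = 0"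
proof -
  obtain n where "0 < n" "n < p" "Legendre (int n) (int p) = -1"
    using exists_Legendre_eq_minus_one[OF prime p_gt_2] by blast
  then have n: "n \<in> {1..<p}" "chi n = -1" by (simp_all add: chi_def)
  have "(\<Sum>k=1..<p. chi k) = (\<Sum>k=1..<p. chi (n * k mod p))"
    by (rule sum.reindex_bij_betw[OF bij_betw_mult_mod_prime[OF n(1)], symmetric])
  also have "\<dots> = - (\<Sum>k=1..<p. chi k)"
    by (simp add: chi_mod chi_mult n sum_negf)
  finally show ?thesis by simp
qed

text \<open>
  Substituting \<open>n k\<close> for \<open>k\<close> in the Gauss sum produces the factor \<open>chi n\<close>, which is its own inverse.
\<close>
lemma twisted_gauss_sum:
  assumes "n \<in> {1..<p}"
  shows "(\<Sum>k=1..<p. chi k * zeta ^ (n * k)) = chi n * gauss_sum"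
proof -
  have "gauss_sum = (\<Sum>k=1..<p. chi (n * k mod p) * zeta ^ (n * k mod p))"
    unfolding gauss_sum_def
    by (rule sum.reindex_bij_betw[OF bij_betw_mult_mod_prime[OF assms], symmetric])
  also have "\<dots> = chi n * (\<Sum>k=1..<p. chi k * zeta ^ (n * k))"
    by (simp add: chi_mod zeta_mod chi_mult sum_distrib_left mult.assoc)
  finally have "chi n * gauss_sum = chi n ^ 2 * (\<Sum>k=1..<p. chi k * zeta ^ (n * k))"
    by (simp add: power2_eq_square)
  then show ?thesis using chi_square[OF assms] by simp
qed

lemma sum_zeta_powers:
  "(\<Sum>k=1..<p. zeta ^ (k * n)) = (if p dvd n then of_nat p else 0) - 1"
proof -
  have "{..<p} = insert 0 {1..<p}" using p_gt_2 by auto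
  then have "(\<Sum>k<p. zeta ^ (k * n)) = 1 + (\<Sum>k=1..<p. zeta ^ (k * n))" by simp
  then show ?thesis
    using sum_roots_of_unity[of p n] p_gt_2 unfolding zeta_def by (simp add: algebra_simps)
qed

text \<open>
  Using \<open>twisted_gauss_sum\<close> to absorb one factor, the square becomes a double sum whose inner sum over
  \<open>a\<close> is geometric. It is \<open>p - 1\<close> for \<open>b = -1\<close> and \<open>-1\<close> otherwise; as the values of \<open>chi\<close> add up to zero,
  only \<open>p chi(-1) = p\<close> is left.
\<close>
lemma gauss_sum_square: "gauss_sum ^ 2 = of_nat p"
proof -
  have "gauss_sum ^ 2 = (\<Sum>a=1..<p. zeta ^ a * (chi a * gauss_sum))"
    by (simp add: gauss_sum_def power2_eq_square sum_distrib_left sum_distrib_right mult_ac)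
  also have "\<dots> = (\<Sum>a=1..<p. \<Sum>b=1..<p. chi b * zeta ^ (a * (1 + b)))"
    by (intro sum.cong refl, subst twisted_gauss_sum[symmetric])
       (simp_all add: sum_distrib_left power_add mult_ac)
  also have "\<dots> = (\<Sum>b=1..<p. chi b * (\<Sum>a=1..<p. zeta ^ (a * (1 + b))))"
    by (subst sum.swap) (simp add: sum_distrib_left)
  also have "\<dots> = (\<Sum>b=1..<p. (if b = p - 1 then of_nat p * chi b else 0) - chi b)"
  proof (intro sum.cong refl)
    fix b assume "b \<in> {1..<p}"
    then have "p dvd 1 + b \<longleftrightarrow> b = p - 1" using p_gt_2 by (auto dest: dvd_imp_le)
    then show "chi b * (\<Sum>a=1..<p. zeta ^ (a * (1 + b))) =
        (if b = p - 1 then of_nat p * chi b else 0) - chi b"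
      unfolding sum_zeta_powers by (simp add: algebra_simps)
  qed
  also have "\<dots> = of_nat p"
  proof -
    have "p - 1 \<in> {1..<p}" using p_gt_2 by auto
    then show ?thesis
      by (simp only: sum_subtractf sum_chi sum.delta finite_atLeastLessThan chi_p_minus_1 if_True) simp
  qed
  finally show ?thesis .
qed

text \<open>
  Since the Gauss sum is a square root of \<open>p\<close>, the squares of these numbers are \<open>p \<zeta>^(2 k)\<close>. The sign
  \<open>chi k\<close> selects one square root of each in a way that is invariant under all automorphisms
  \<open>\<zeta> \<mapsto> \<zeta>^j\<close>, because these multiply the Gauss sum by \<open>chi j\<close>. Invariance is what makes the product
  below have rational coefficients.
\<close>
definition aurifeuillian_root :: "nat \<Rightarrow> complex" where
  "aurifeuillian_root k = chi k * zeta ^ k * gauss_sum"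

definition aurifeuillian_poly :: "complex poly" where
  "aurifeuillian_poly = (\<Prod>k=1..<p. [:1, - aurifeuillian_root k:])"

text \<open>
  For even exponents the signs disappear and the roots of unity sum up to \<open>-1\<close>; for odd exponents
  a further Gauss sum appears and completes the power of \<open>gauss_sum\<close> to an even one. The bound on \<open>n\<close>
  keeps \<open>n\<close> prime to \<open>p\<close> in the odd case.
\<close>
lemma aurifeuillian_power_sum_in_Ints:
  assumes "0 < n" "n \<le> p - 1"
  shows "(\<Sum>k=1..<p. aurifeuillian_root k ^ n) \<in> \<int>"
proof (cases "even n")
  case True
  then obtain l where l: "n = 2 * l" ..
  have "(\<Sum>k=1..<p. aurifeuillian_root k ^ n) = (\<Sum>k=1..<p. of_nat p ^ l * zeta ^ (k * n))"
  proof (intro sum.cong refl)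
    fix k assume "k \<in> {1..<p}"
    then have "chi k ^ n = 1" "gauss_sum ^ n = of_nat p ^ l"
      by (simp_all add: l power_mult chi_square gauss_sum_square)
    then show "aurifeuillian_root k ^ n = of_nat p ^ l * zeta ^ (k * n)"
      by (simp add: aurifeuillian_root_def power_mult_distrib power_mult)
  qed
  then show ?thesis
    unfolding sum_distrib_left[symmetric] sum_zeta_powers by auto
next
  case False
  then obtain l where l: "n = 2 * l + 1" by (rule oddE)
  have "(\<Sum>k=1..<p. aurifeuillian_root k ^ n) = gauss_sum ^ n * (\<Sum>k=1..<p. chi k * zeta ^ (n * k))"
    unfolding sum_distrib_left
  proof (intro sum.cong refl)
    fix k assume "k \<in> {1..<p}"
    then have "chi k ^ n = chi k"
      by (simp add: l power_add power_mult chi_square)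
    then show "aurifeuillian_root k ^ n = gauss_sum ^ n * (chi k * zeta ^ (n * k))"
      by (simp add: aurifeuillian_root_def power_mult_distrib power_mult flip: power_mult)
         (simp add: mult_ac)
  qed
  also have "\<dots> = gauss_sum ^ (2 * Suc l) * chi n"
    using assms by (subst twisted_gauss_sum) (auto simp: l)
  also have "\<dots> = of_nat p ^ Suc l * chi n"
    by (simp only: power_mult gauss_sum_square)
  finally show ?thesis by (simp add: chi_def)
qed

lemma prod_nontrivial_roots_of_unity:
  "(\<Prod>k=1..<p. [:1, - (zeta ^ k):]) = (\<Sum>j<p. [:0, 1:] ^ j)"
proof -
  have p0: "p > 0" using p_gt_2 by simp
  have split: "{..<p} = insert 0 {1..<p}" using p_gt_2 by auto
  have z: "zeta ^ k = cis (2 * pi * real k / real p)" for k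
    by (simp add: zeta_def DeMoivre mult_ac)
  \<comment> \<open>The root \<open>1\<close> contributes the factor \<open>1 - X\<close>, which is cancelled at the end.\<close>
  have "(1 - [:0, 1:]) * (\<Prod>k=1..<p. [:1, - (zeta ^ k):]) = (\<Prod>k<p. [:1, - (zeta ^ k):])"
    unfolding split by (simp add: one_pCons)
  also have "\<dots> = (\<Prod>z | z ^ p = 1. [:1, - z:])"
    unfolding z by (rule prod.reindex_bij_betw[OF bij_betw_roots_unity[OF p0]])
  also have "\<dots> = (1 - [:0, 1:]) * (\<Sum>j<p. [:0, 1:] ^ j)"
    unfolding prod_roots_of_unity_linear[OF p0] one_diff_power_eq ..
  finally show ?thesis
    by (rule mult_left_cancel[THEN iffD1, rotated]) (simp add: one_pCons)
qed

text \<open>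
  The factors pair up as \<open>(1 - r X)(1 + r X) = 1 - p \<zeta>^(2 k) X\<^sup>2\<close>, and doubling permutes the nontrivial
  residues, so the product is the \<open>p\<close>-th cyclotomic polynomial evaluated at \<open>p X\<^sup>2\<close>.
\<close>
lemma aurifeuillian_poly_reflection:
  "aurifeuillian_poly * pcompose aurifeuillian_poly [:0, -1:] = (\<Sum>j<p. [:0, 0, of_nat p:] ^ j)"
proof -
  have two: "2 \<in> {1..<p}" using p_gt_2 by simp
  have "aurifeuillian_poly * pcompose aurifeuillian_poly [:0, -1:] =
      (\<Prod>k=1..<p. [:1, - aurifeuillian_root k:] * [:1, aurifeuillian_root k:])"
    unfolding aurifeuillian_poly_def pcompose_prod prod.distrib
    by (simp add: pcompose_pCons)
  also have "\<dots> = (\<Prod>k=1..<p. pcompose [:1, - (zeta ^ (2 * k mod p)):] [:0, 0, of_nat p:])"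
  proof (intro prod.cong refl)
    fix k assume "k \<in> {1..<p}"
    then have "aurifeuillian_root k ^ 2 = of_nat p * zeta ^ (2 * k mod p)"
      by (simp add: aurifeuillian_root_def power_mult_distrib chi_square gauss_sum_square zeta_mod
            mult.commute flip: power_mult)
    then show "[:1, - aurifeuillian_root k:] * [:1, aurifeuillian_root k:] =
        pcompose [:1, - (zeta ^ (2 * k mod p)):] [:0, 0, of_nat p:]"
      by (simp add: pcompose_pCons power2_eq_square mult.commute)
  qed
  also have "\<dots> = (\<Prod>k=1..<p. pcompose [:1, - (zeta ^ k):] [:0, 0, of_nat p:])"
    by (rule prod.reindex_bij_betw[OF bij_betw_mult_mod_prime[OF two]])
  also have "\<dots> = (\<Sum>j<p. [:0, 0, of_nat p:] ^ j)"
    unfolding pcompose_prod[symmetric] prod_nontrivial_roots_of_unity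
    by (simp add: pcompose_sum pcompose_power pcompose_pCons)
  finally show ?thesis .
qed

lemma degree_aurifeuillian_poly: "degree aurifeuillian_poly \<le> p - 1"
proof -
  have "degree aurifeuillian_poly \<le> (\<Sum>k=1..<p. degree [:1, - aurifeuillian_root k:])"
    unfolding aurifeuillian_poly_def by (rule order.trans[OF degree_prod_sum_le]) simp_all
  also have "\<dots> \<le> (\<Sum>k=1..<p. 1)" by (intro sum_mono) simp
  finally show ?thesis by simp
qed

text \<open>
  The factorization of Aurifeuille and Lucas of the cyclotomic polynomial at \<open>p X\<^sup>2\<close>. The complex
  factor found above becomes integral after multiplication by \<open>(p - 1)!\<close>, by Newton's identities; Gauss's
  lemma then shows that it was integral from the start.
\<close>
lemma aurifeuillian_factorization:
  "\<exists>F :: int poly. F * pcompose F [:0, -1:] = (\<Sum>j<p. [:0, 0, int p:] ^ j)"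
proof -
  let ?P = aurifeuillian_poly
  define D :: int where "D = fact (p - 1)"
  have "of_int D * poly.coeff ?P n \<in> \<int>" for n
  proof (cases "n \<le> p - 1")
    case True
    have "fact n dvd D" unfolding D_def using True by (rule fact_dvd)
    then obtain q where q: "D = fact n * q" ..
    have "fact n * poly.coeff ?P n \<in> \<int>"
      unfolding aurifeuillian_poly_def
      by (rule fact_mult_coeff_prod_linear_in_Ints[where N = "p - 1"])
         (use True aurifeuillian_power_sum_in_Ints in auto)
    then have "of_int q * (fact n * poly.coeff ?P n) \<in> \<int>" by simp
    then show ?thesis by (simp add: q mult_ac)
  next
    case False
    then have "poly.coeff ?P n = 0"
      using degree_aurifeuillian_poly by (intro coeff_eq_0) simp
    then show ?thesis by simp
  qed
  then have "\<forall>n. \<exists>h. of_int D * poly.coeff ?P n = of_int h" by (auto elim: Ints_cases)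
  then obtain h where h: "\<And>n. of_int D * poly.coeff ?P n = of_int (h n)" by metis
  have "h n = 0" if "degree ?P < n" for n
    using that h[of n] by (simp add: coeff_eq_0)
  then have H: "poly.coeff (Abs_poly h) n = h n" for n
    by (subst coeff_Abs_poly[of "degree ?P"]) auto
  have pow: "[:0, 0, c:] ^ j = Polynomial.monom (c ^ j) (2 * j)" for c :: "'a :: comm_ring_1" and j
    by (induction j) (simp_all add: monom_Suc smult_monom)
  have S: "of_int (poly.coeff (\<Sum>j<p. [:0, 0, int p:] ^ j) n) =
      poly.coeff (\<Sum>j<p. [:0, 0, of_nat p:] ^ j :: complex poly) n" for n
    by (simp add: pow coeff_sum if_distrib cong: if_cong)
  have "Abs_poly h * pcompose (Abs_poly h) [:0, -1:] =
      Polynomial.smult (D ^ 2) (\<Sum>j<p. [:0, 0, int p:] ^ j)"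
  proof (rule poly_eqI)
    fix n
    have "of_int (poly.coeff (Abs_poly h * pcompose (Abs_poly h) [:0, -1:]) n) =
        of_int D ^ 2 * poly.coeff (?P * pcompose ?P [:0, -1:]) n"
    proof -
      have "of_int (h i * ((- 1) ^ (n - i) * h (n - i))) =
          of_int D ^ 2 * (poly.coeff ?P i * ((- 1) ^ (n - i) * poly.coeff ?P (n - i)))" for i
        by (simp add: h[symmetric] power2_eq_square)
      then show ?thesis
        by (simp only: coeff_mult coeff_pcompose_linear H sum_distrib_left of_int_sum)
    qed
    also have "\<dots> = of_int (poly.coeff (Polynomial.smult (D ^ 2) (\<Sum>j<p. [:0, 0, int p:] ^ j)) n)"
      unfolding aurifeuillian_poly_reflection S[symmetric] by simp
    finally show "poly.coeff (Abs_poly h * pcompose (Abs_poly h) [:0, -1:]) n =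
        poly.coeff (Polynomial.smult (D ^ 2) (\<Sum>j<p. [:0, 0, int p:] ^ j)) n"
      by (simp only: of_int_eq_iff)
  qed
  moreover have "content (\<Sum>j<p. [:0, 0, int p:] ^ j) = 1"
  proof -
    have "poly.coeff (\<Sum>j<p. [:0, 0, int p:] ^ j) 0 = (\<Sum>j<p. 0 ^ j)"
      by (simp add: coeff_sum coeff_0_power)
    also have "\<dots> = 1" using p_gt_2 by (simp add: power_0_left)
    finally have "content (\<Sum>j<p. [:0, 0, int p:] ^ j) dvd 1"
      using content_dvd_coeff[of "\<Sum>j<p. [:0, 0, int p:] ^ j" 0] by simp
    then have "normalize (content (\<Sum>j<p. [:0, 0, int p:] ^ j)) = 1"
      by (rule is_unit_normalize)
    then show ?thesis unfolding normalize_content .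
  qed
  ultimately show ?thesis
    using gauss_reflection_factor[of "Abs_poly h" D "\<Sum>j<p. [:0, 0, int p:] ^ j"]
    unfolding D_def by (metis fact_gt_zero)
qed

end

section \<open>The polynomial of degree four\<close>

text \<open>
  The sum is the \<open>p\<close>-th cyclotomic polynomial at \<open>-p m\<^sup>2\<close>. The factorization at \<open>p X\<^sup>2\<close> applies with \<open>X = i m\<close>.
\<close>
lemma cyclotomic_value_sum_two_squares:
  fixes m :: "int poly"
  assumes "prime p" "[p = 1] (mod 4)"
  shows "\<exists>g h. (\<Sum>j<p. (- (of_nat p * m ^ 2)) ^ j) = g ^ 2 + h ^ 2"
proof -
  define T :: "int poly" where "T = (\<Sum>j<p. [:0, int p:] ^ j)"
  obtain F :: "int poly" where "F * pcompose F [:0, -1:] = (\<Sum>j<p. [:0, 0, int p:] ^ j)"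
    using aurifeuillian_factorization[OF assms] by blast
  also have "\<dots> = pcompose T [:0, 0, 1:]"
    by (simp add: T_def pcompose_sum pcompose_power pcompose_pCons)
  finally obtain g h where "pcompose T (- (m ^ 2)) = g ^ 2 + h ^ 2"
    using reflection_factor_sum_two_squares by blast
  moreover have "pcompose T (- (m ^ 2)) = (\<Sum>j<p. (- (of_nat p * m ^ 2)) ^ j)"
    by (simp add: T_def pcompose_sum pcompose_power pcompose_pCons of_nat_poly)
  ultimately show ?thesis by auto
qed

text \<open>
  That \<open>a d - b c\<close> and \<open>t\<close> are nonnegative is what makes \<open>m\<close> positive on the positive
  integers; it will exclude the zeros of \<open>p m\<^sup>2\<close>, which would be perfect squares.
\<close>
lemma exists_quadratic_polynomial:
  assumes "prime p" "[p = 1] (mod 4)"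
  shows "\<exists>m u v :: int poly. degree m = 2 \<and> (\<forall>n>0. poly m n > 0) \<and> of_nat p * m ^ 2 + 1 = u ^ 2 + v ^ 2"
proof -
  obtain a b where ab: "int p = a ^ 2 + b ^ 2"
    using sum_two_squares_prime[OF assms] by blast
  have p: "prime (int p)" using assms(1) by simp
  have "coprime a b"
  proof (rule coprimeI)
    fix k assume "k dvd a" "k dvd b"
    then have "k ^ 2 dvd int p" unfolding ab by (intro dvd_add dvd_power_same)
    moreover have "squarefree (int p)" using p by (intro squarefree_prime)
    ultimately show "is_unit k" by (rule squarefreeD[rotated])
  qed
  moreover have "odd (a + b)"
  proof
    assume "even (a + b)"
    then have "even (a ^ 2 + b ^ 2)" by simp
    then have "even p" using ab by (metis even_of_nat)
    then show False using assms(2) by (auto simp: cong_def elim!: evenE) presburger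
  qed
  ultimately obtain c d t where cdt: "a * c + b * d = 1" "c ^ 2 + d ^ 2 = 2 * t + 1"
      "a * d - b * c \<ge> 0" "t \<ge> 0"
    using bezout_odd_norm by blast
  define m where "m = [:t, 2 * (a * d - b * c), 2 * int p:]"
  have "of_int (int p) * m ^ 2 + 1 =
      (of_int a * m - of_int c + 2 * of_int b * [:0, 1:]) ^ 2 +
      (of_int b * m - of_int d - 2 * of_int a * [:0, 1:]) ^ 2"
  proof (rule quadratic_square_plus_one)
    show "of_int (int p) = of_int a ^ 2 + (of_int b ^ 2 :: int poly)"
      unfolding ab by simp
    show "of_int a * of_int c + of_int b * of_int d = (1 :: int poly)"
      using arg_cong[OF cdt(1), of "of_int :: int \<Rightarrow> int poly"] by simp
    show "of_int c ^ 2 + of_int d ^ 2 = 2 * of_int t + (1 :: int poly)"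
      using arg_cong[OF cdt(2), of "of_int :: int \<Rightarrow> int poly"] by simp
    show "m = 2 * of_int (int p) * [:0, 1:] ^ 2 +
        2 * (of_int a * of_int d - of_int b * of_int c) * [:0, 1:] + of_int t"
      by (simp add: m_def of_int_poly of_nat_poly numeral_poly power2_eq_square)
  qed
  moreover have "degree m = 2" using p by (simp add: m_def)
  moreover have "poly m n > 0" if "n > 0" for n
  proof -
    have "n * n * int p > 0" using that prime_gt_0_int[OF p] by simp
    moreover have "n * (a * d - b * c) \<ge> 0" using that cdt(3) by (intro mult_nonneg_nonneg) auto
    moreover have "poly m n = t + 2 * (n * (a * d - b * c)) + 2 * (n * n * int p)"
      by (simp add: m_def algebra_simps)
    ultimately show ?thesis using cdt(4) by linarith
  qed
  ultimately show ?thesis by (metis of_int_of_nat_eq)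
qed

text \<open>
  The multiplicity of \<open>p\<close> is odd on the left and even on the right.
\<close>
lemma prime_mult_square_not_square:
  fixes p x y :: "'a :: factorial_semiring_multiplicative"
  assumes "prime p" "x \<noteq> 0"
  shows "p * x ^ 2 \<noteq> y ^ 2"
proof
  assume eq: "p * x ^ 2 = y ^ 2"
  have p: "prime_elem p" using assms(1) by (rule prime_imp_prime_elem)
  then have "p \<noteq> 0" by auto
  then have "y \<noteq> 0" using eq assms(2) by auto
  have "multiplicity p (p * x ^ 2) = Suc (2 * multiplicity p x)"
    using p \<open>p \<noteq> 0\<close> assms(2)
    by (simp add: prime_elem_multiplicity_mult_distrib prime_elem_multiplicity_power_distrib
          multiplicity_self prime_elem_not_unit)
  moreover have "multiplicity p (y ^ 2) = 2 * multiplicity p y"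
    using p \<open>y \<noteq> 0\<close> by (simp add: prime_elem_multiplicity_power_distrib)
  ultimately have "Suc (2 * multiplicity p x) = 2 * multiplicity p y" using eq by simp
  then show False by presburger
qed

theorem theorem1p9:
  fixes p :: nat
  assumes "prime p"
    and "[p = 1] (mod 4)"
  shows "\<exists>f :: int poly. degree f = 4
    \<and> (\<exists>g h :: int poly. f ^ p + 1 = g ^ 2 + h ^ 2)
    \<and> \<not> (\<exists>n :: nat. n > 0 \<and> is_nth_power 2 (poly f (int n)))"
proof -
  obtain m u v :: "int poly" where m: "degree m = 2" "\<And>n. n > 0 \<Longrightarrow> poly m n > 0"
      and uv: "of_nat p * m ^ 2 + 1 = u ^ 2 + v ^ 2"
    using exists_quadratic_polynomial[OF assms] by blast
  define f where "f = of_nat p * m ^ 2"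
  obtain g h where gh: "(\<Sum>j<p. (- f) ^ j) = g ^ 2 + h ^ 2"
    using cyclotomic_value_sum_two_squares[OF assms] unfolding f_def by blast
  have p: "p > 0" "odd p"
    using assms by (auto simp: prime_gt_0_nat cong_def elim!: evenE) presburger
  have "f ^ p + 1 = 1 - (- f) ^ p" using p by simp
  also have "\<dots> = (f + 1) * (\<Sum>j<p. (- f) ^ j)"
    by (simp add: one_diff_power_eq add.commute)
  also have "\<dots> = (u ^ 2 + v ^ 2) * (g ^ 2 + h ^ 2)"
    using uv gh by (simp add: f_def)
  \<comment> \<open>Sums of two squares are closed under multiplication (Brahmagupta).\<close>
  also have "\<dots> = (u * g - v * h) ^ 2 + (u * h + v * g) ^ 2"
    by (simp add: power2_eq_square algebra_simps)
  finally have squares: "f ^ p + 1 = (u * g - v * h) ^ 2 + (u * h + v * g) ^ 2" .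
  have "m \<noteq> 0" using m(1) by auto
  then have "degree f = 4"
    using m(1) p by (simp add: f_def of_nat_poly degree_power_eq)
  moreover have "\<not> is_nth_power 2 (poly f (int n))" if "n > 0" for n
  proof
    assume "is_nth_power 2 (poly f (int n))"
    then obtain y where "int p * poly m (int n) ^ 2 = y ^ 2"
      by (auto simp: is_nth_power_def f_def)
    moreover have "poly m (int n) \<noteq> 0" using m(2)[of "int n"] that by simp
    ultimately show False
      using prime_mult_square_not_square[of "int p" "poly m (int n)" y] assms(1) by simp
  qed
  ultimately show ?thesis using squares by blast
qed

end
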